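(* Let $J,m,n_1,\dots,n_J$ be positive integers and let $\Psi(x,y)=\sum_{j=1}^J\Psi_j(x_j,y)$ for $x=(x_1,\dots,x_J)$, $x_j\in\mathbb{C}^{n_j}$, $y\in\mathbb{C}^m$, where (a) for each $j=1,\dots,J$, $\Psi_j:\mathbb{C}^{n_j}\times\mathbb{C}^m\to\mathbb{R}$ is $C^1$, that is, $\nabla_{x_j}\Psi_j(x_j,y)$ and $\nabla_y\Psi_j(x_j,y)$ are both continuous; (b) $\inf_{(x,y)\in\mathbb{C}^{n_1+\dots+n_J}\times\mathbb{C}^m}\Psi(x,y)>-\infty$. Let $\gamma,\beta>0$ and let $\{z^k=(x^k,y^k)\}_{k\in\mathbb{N}}$, $x^k=(x_1^k,\dots,x_J^k)$, be a sequence generated by the IRCSI-type method, i.e. for all $k\ge0$ $$x_j^{k+1}=x_j^k+s_j^kv_j^k,\quad j=1,\dots,J,$$ $$s_j^k\in\mathop{\arg\min}_{s\in\mathbb{C}}\Psi_j(x_j^k+sv_j^k,y^k)+\gamma\|sv_j^k\|_1,$$ $$y^{k+1}\in\mathop{\arg\min}_{y\in\mathbb{C}^m}\sum_{j=1}^J\Psi_j(x_j^{k+1},y)+\beta\|y-y^k\|_1,$$ where, with $g_j^k=\nabla_{x_j}\Psi_j(x_j^k,y^k)$, the direction $v_j^k$ is $$v_j^k=\begin{cases}g_j^0,&k=0,\\ g_j^k+\dfrac{\mathrm{Re}\langle g_j^k,g_j^k-g_j^{k-1}\rangle}{\|g_j^{k-1}\|^2}v_j^{k-1},&k\ge1\text{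 and }g_j^{k-1}\ne0,\\ g_j^k,&k\ge1\text{ and }g_j^{k-1}=0.\end{cases}$$ Then the following statements hold: (i) The sequence $\{z^k\}_{k\in\mathbb{N}}$ is convergent. (ii) Let $L\ge\max_{1\le j\le J}\sqrt{n_j}$ be a constant such that $\|\xi\|_1\le L\|\xi\|$ for any $\xi\in\mathbb{C}^{n_j}$, $j=1,\dots,J$, and let $\varepsilon=\max\{\gamma L,\beta\}$. Then the limit point $z^*$ of $\{z^k\}_{k\in\mathbb{N}}$ is an $\varepsilon$-stationary point of the objective function $\Psi$, that is, $$\|\nabla\Psi(z^* )\|_\infty\le\varepsilon.$$
   Context: $\|\cdot\|$, $\|\cdot\|_1$, $\|\cdot\|_\infty$ denote the $\ell_2$-norm, the $\ell_1$-norm (sum of moduli) and the infinity norm (maximum modulus) of complex vectors, and $\langle\cdot,\cdot\rangle$ is the standard inner product of complex vectors. For a real-valued function $\psi:\mathbb{C}^q\to\mathbb{R}$, write $w=w_r+iw_i$ with $w_r,w_i\in\mathbb{R}^q$ and $\psi(w)=\widetilde\psi(w_r,w_i)$. $\psi$ is called continuously differentiable ($\psi\in C^1$) if $\widetilde\psi$ is continuously differentiable on $\mathbb{R}^q\times\mathbb{R}^q$, and its complex gradient is $\nabla_w\psi(w):=\nabla_{w_r}\widetilde\psi(w_r,w_i)+i\nabla_{w_i}\widetilde\psi(w_r,w_i)$. Accordingly $\nabla\Psi=(\nabla_{x_1}\Psi,\dots,\nabla_{x_J}\Psi,\nabla_y\Psi)$ is the complex gradient of $\Psi$ with respect to all its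 variables. The initial point $z^0=(x^0,y^0)$ is any given point. *)

theory Defs
  imports "HOL-Analysis.Analysis"
begin

text \<open>
  The block dimensions vary with the block, so a vector of length \<open>q\<close> is a function
  \<open>nat \<Rightarrow> complex\<close> vanishing outside \<open>{..<q}\<close>. On this set the product topology of the
  function type is the Euclidean topology.
\<close>

definition cvec :: "nat \<Rightarrow> (nat \<Rightarrow> complex) set" where
  "cvec q = {w. \<forall>i\<ge>q. w i = 0}"

definition blocks :: "nat \<Rightarrow> (nat \<Rightarrow> nat) \<Rightarrow> (nat \<Rightarrow> nat \<Rightarrow> complex) set" where
  "blocks J n = (\<Pi>\<^sub>E j\<in>{1..J}. cvec (n j))"

text \<open>Norms of complex vectors whose coordinates are indexed by a finite set \<open>I\<close>.\<close>

definition l1_norm :: "'i set \<Rightarrow> ('i \<Rightarrow> complex) \<Rightarrow> real" where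
  "l1_norm I w = (\<Sum>i\<in>I. cmod (w i))"

definition l2_norm :: "'i set \<Rightarrow> ('i \<Rightarrow> complex) \<Rightarrow> real" where
  "l2_norm I w = L2_set (\<lambda>i. cmod (w i)) I"

definition linf_norm :: "'i set \<Rightarrow> ('i \<Rightarrow> complex) \<Rightarrow> real" where
  "linf_norm I w = Max ((\<lambda>i. cmod (w i)) ` I)"

definition cinner :: "'i set \<Rightarrow> ('i \<Rightarrow> complex) \<Rightarrow> ('i \<Rightarrow> complex) \<Rightarrow> complex" where
  "cinner I u w = (\<Sum>i\<in>I. u i * cnj (w i))"

text \<open>
  The real functions of \<open>t\<close> along which the partial derivatives with respect to the real and the
  imaginary part of the \<open>i\<close>-th coordinate are taken, at \<open>t = 0\<close>.
\<close>

definition re_slice :: "((nat \<Rightarrow> complex) \<Rightarrow> real) \<Rightarrow> (nat \<Rightarrow> complex) \<Rightarrow> nat \<Rightarrow> real \<Rightarrow> real" where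
  "re_slice \<psi> w i t = \<psi> (w(i := w i + of_real t))"

definition im_slice :: "((nat \<Rightarrow> complex) \<Rightarrow> real) \<Rightarrow> (nat \<Rightarrow> complex) \<Rightarrow> nat \<Rightarrow> real \<Rightarrow> real" where
  "im_slice \<psi> w i t = \<psi> (w(i := w i + \<i> * of_real t))"

definition has_partials :: "nat \<Rightarrow> ((nat \<Rightarrow> complex) \<Rightarrow> real) \<Rightarrow> (nat \<Rightarrow> complex) \<Rightarrow> bool" where
  "has_partials q \<psi> w \<longleftrightarrow>
     (\<forall>i<q. re_slice \<psi> w i field_differentiable (at 0) \<and> im_slice \<psi> w i field_differentiable (at 0))"

definition cgrad :: "nat \<Rightarrow> ((nat \<Rightarrow> complex) \<Rightarrow> real) \<Rightarrow> (nat \<Rightarrow> complex) \<Rightarrow> nat \<Rightarrow> complex" where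
  "cgrad q \<psi> w = (\<lambda>i. if i < q
     then of_real (deriv (re_slice \<psi> w i) 0) + \<i> * of_real (deriv (im_slice \<psi> w i) 0)
     else 0)"

text \<open>
  Continuous differentiability on the product of \<open>cvec p\<close> and \<open>cvec q\<close>: all real partial
  derivatives exist and both partial complex gradients are jointly continuous.
\<close>

definition C1_on_prod ::
  "nat \<Rightarrow> nat \<Rightarrow> ((nat \<Rightarrow> complex) \<Rightarrow> (nat \<Rightarrow> complex) \<Rightarrow> real) \<Rightarrow> bool" where
  "C1_on_prod p q \<phi> \<longleftrightarrow>
     (\<forall>u\<in>cvec p. \<forall>y\<in>cvec q. has_partials p (\<lambda>u'. \<phi> u' y) u \<and> has_partials q (\<lambda>y'. \<phi> u y') y) \<and>
     continuous_on (cvec p \<times> cvec q) (\<lambda>(u, y). cgrad p (\<lambda>u'. \<phi> u' y) u) \<and>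
     continuous_on (cvec p \<times> cvec q) (\<lambda>(u, y). cgrad q (\<lambda>y'. \<phi> u y') y)"

definition total_obj ::
  "nat \<Rightarrow> (nat \<Rightarrow> (nat \<Rightarrow> complex) \<Rightarrow> (nat \<Rightarrow> complex) \<Rightarrow> real)
     \<Rightarrow> (nat \<Rightarrow> nat \<Rightarrow> complex) \<Rightarrow> (nat \<Rightarrow> complex) \<Rightarrow> real" where
  "total_obj J \<psi> x y = (\<Sum>j=1..J. \<psi> j (x j) y)"

text \<open>
  The complex gradient with respect to all variables: \<open>Inl (j, i)\<close> indexes the \<open>i\<close>-th
  coordinate of the block \<open>x\<^sub>j\<close>, and \<open>Inr i\<close> the \<open>i\<close>-th coordinate of \<open>y\<close>.
\<close>

definition full_index :: "nat \<Rightarrow> (nat \<Rightarrow> nat) \<Rightarrow> nat \<Rightarrow> (nat \<times> nat + nat) set" where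
  "full_index J n m = (SIGMA j:{1..J}. {..<n j}) <+> {..<m}"

definition full_grad ::
  "(nat \<Rightarrow> nat) \<Rightarrow> nat \<Rightarrow> ((nat \<Rightarrow> nat \<Rightarrow> complex) \<Rightarrow> (nat \<Rightarrow> complex) \<Rightarrow> real)
     \<Rightarrow> (nat \<Rightarrow> nat \<Rightarrow> complex) \<Rightarrow> (nat \<Rightarrow> complex) \<Rightarrow> nat \<times> nat + nat \<Rightarrow> complex" where
  "full_grad n m \<Phi> x y = case_sum
     (\<lambda>(j, i). cgrad (n j) (\<lambda>u. \<Phi> (x(j := u)) y) (x j) i)
     (\<lambda>i. cgrad m (\<lambda>y'. \<Phi> x y') y i)"

end

theory Submission
  imports Defs
begin

text \<open>
  Comparing each minimiser with the trivial choice \<open>s = 0\<close>, respectively \<open>y = y\<^sup>k\<close>, shows that the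
  objective drops by at least \<open>\<gamma> \<Sum>\<^sub>j \<parallel>x\<^sub>j\<^sup>k\<^sup>+\<^sup>1 - x\<^sub>j\<^sup>k\<parallel>\<^sub>1 + \<beta> \<parallel>y\<^sup>k\<^sup>+\<^sup>1 - y\<^sup>k\<parallel>\<^sub>1\<close>. It is bounded below, so the
  iterates have finite length and converge.

  First-order optimality of \<open>y\<^sup>k\<^sup>+\<^sup>1\<close> bounds every entry of the \<open>y\<close>-gradient by \<open>\<beta>\<close>, and this passes to
  the limit. For a block \<open>j\<close>, let \<open>G\<close> be the limit of the gradients \<open>g\<^sub>j\<^sup>k\<close>. If \<open>G \<noteq> 0\<close>, the conjugate
  gradient coefficients tend to \<open>0\<close> because consecutive gradients approach each other, hence
  \<open>v\<^sub>j\<^sup>k\<close> also tends to \<open>G\<close>. First-order optimality of the line search then gives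
  \<open>\<parallel>G\<parallel>\<^sup>2 \<le> \<gamma> \<parallel>G\<parallel>\<^sub>1 \<le> \<gamma> L \<parallel>G\<parallel>\<close> in the limit.
\<close>

lemma tendsto_fun_iff:
  fixes f :: "'a \<Rightarrow> 'b \<Rightarrow> 'c::topological_space"
  shows "(f \<longlongrightarrow> l) F \<longleftrightarrow> (\<forall>i. ((\<lambda>x. f x i) \<longlongrightarrow> l i) F)"
  using limitin_componentwise[of "\<lambda>_. euclidean" UNIV f l F]
  by (simp add: euclidean_product_topology)

lemma cvec_fun_upd: "w \<in> cvec q \<Longrightarrow> i < q \<Longrightarrow> w(i := c) \<in> cvec q"
  by (auto simp: cvec_def)

lemma cgrad_in_cvec: "cgrad q F w \<in> cvec q"
  by (simp add: cvec_def cgrad_def)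

text \<open>The hypotheses are asymmetric on purpose: in the first variable only the derivative at
  the origin is known, in the second a partial derivative that is jointly continuous. This already
  gives joint differentiability at the origin. The first variable will later carry a whole curve of
  coordinates already moved, the second one fresh real coordinate.\<close>

lemma has_real_derivative_two_variables:
  fixes h D :: "real \<Rightarrow> real \<Rightarrow> real"
  assumes fst: "((\<lambda>t. h t 0) has_real_derivative A) (at 0)"
    and snd: "\<And>t r. (h t has_real_derivative D t r) (at r)"
    and cont: "continuous_on UNIV (\<lambda>(t, r). D t r)"
  shows "((\<lambda>t. h t (a * t)) has_real_derivative A + a * D 0 0) (at 0)"
proof -
  \<comment> \<open>The partial derivative in the second variable as a bounded linear map, the form
    in which its continuity has to be supplied.\<close>
  define fy where "fy t r = D t r *\<^sub>R (id_blinfun :: real \<Rightarrow>\<^sub>L real)" for t r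
  have fy_apply: "blinfun_apply (fy t r) = (\<lambda>z. D t r * z)" for t r
    by (auto simp: fy_def fun_eq_iff blinfun.scaleR_left)
  have "((\<lambda>(t, r). h t r) has_derivative (\<lambda>(z, z'). A * z + fy 0 0 z')) (at (0, 0) within UNIV \<times> UNIV)"
  proof (rule has_derivative_partialsI[where f = h and fx = "(*) A" and fy = fy])
    show "((\<lambda>t. h t 0) has_derivative (*) A) (at 0)"
      using fst by (simp add: has_field_derivative_def)
    show "(h t has_derivative blinfun_apply (fy t r)) (at r)" for t r
      using snd[of t r] by (simp add: has_field_derivative_def fy_apply)
    have "continuous_on UNIV (\<lambda>(t, r). fy t r)"
      using cont by (auto simp: fy_def case_prod_unfold intro!: continuous_intros)
    then show "continuous (at (0, 0) within UNIV \<times> UNIV) (\<lambda>(t, r). fy t r)"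
      by (simp add: continuous_on_eq_continuous_within)
  qed auto
  then have joint: "((\<lambda>(t, r). h t r) has_derivative (\<lambda>(z, z'). A * z + D 0 0 * z')) (at (0, a * 0))"
    by (simp add: fy_apply)
  \<comment> \<open>Restricting the joint derivative to the line of slope \<open>a\<close> through
    the origin gives the claim.\<close>
  have "((\<lambda>t. (t, a * t)) has_derivative (\<lambda>z. (z, a * z))) (at 0)"
    by (auto intro!: derivative_eq_intros)
  from has_derivative_compose[OF this joint]
  have "((\<lambda>t. h t (a * t)) has_derivative (\<lambda>z. A * z + D 0 0 * (a * z))) (at 0)"
    by simp
  moreover have "(\<lambda>z. A * z + D 0 0 * (a * z)) = (*) (A + a * D 0 0)"
    by (simp add: fun_eq_iff algebra_simps)
  ultimately show ?thesis
    by (simp add: has_field_derivative_def)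
qed

text \<open>\<open>cgrad\<close> differentiates slices based at the moved point, at parameter 0;
  shifting the parameter by \<open>r\<close> turns this into a derivative at \<open>r\<close> of one
  fixed function.\<close>

lemma has_real_derivative_re_coordinate:
  assumes "has_partials q F (w(i := w i + of_real r))" and "i < q"
  shows "((\<lambda>r. F (w(i := w i + of_real r))) has_real_derivative
           Re (cgrad q F (w(i := w i + of_real r)) i)) (at r)"
proof -
  let ?w = "w(i := w i + of_real r)"
  have "(re_slice F ?w i has_real_derivative deriv (re_slice F ?w i) 0) (at 0)"
    using assms by (simp add: has_partials_def DERIV_deriv_iff_field_differentiable)
  moreover have "re_slice F ?w i = (\<lambda>t. F (w(i := w i + of_real (r + t))))"
    by (simp add: re_slice_def fun_eq_iff add.assoc)
  ultimately show ?thesis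
    using assms(2) DERIV_shift[of "\<lambda>r. F (w(i := w i + of_real r))" "Re (cgrad q F ?w i)" 0 r]
    by (simp del: of_real_add add: cgrad_def add.commute[of _ r])
qed

lemma has_real_derivative_im_coordinate:
  assumes "has_partials q F (w(i := w i + \<i> * of_real r))" and "i < q"
  shows "((\<lambda>r. F (w(i := w i + \<i> * of_real r))) has_real_derivative
           Im (cgrad q F (w(i := w i + \<i> * of_real r)) i)) (at r)"
proof -
  let ?w = "w(i := w i + \<i> * of_real r)"
  have "(im_slice F ?w i has_real_derivative deriv (im_slice F ?w i) 0) (at 0)"
    using assms by (simp add: has_partials_def DERIV_deriv_iff_field_differentiable)
  moreover have "im_slice F ?w i = (\<lambda>t. F (w(i := w i + \<i> * of_real (r + t))))"
    by (simp add: im_slice_def fun_eq_iff algebra_simps)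
  ultimately show ?thesis
    using assms(2) DERIV_shift[of "\<lambda>r. F (w(i := w i + \<i> * of_real r))" "Im (cgrad q F ?w i)" 0 r]
    by (simp del: of_real_add add: cgrad_def add.commute[of _ r])
qed

text \<open>Provides the joint continuity required by the two-variable chain rule;
  \<open>c = 1\<close> serves real parts and \<open>c = \<i>\<close> imaginary parts.\<close>

lemma cgrad_coordinate_perturbation_continuous:
  assumes grad: "continuous_on (cvec q) (cgrad q F)"
    and W: "\<And>t. W t \<in> cvec q" "\<And>l. continuous_on UNIV (\<lambda>t::real. W t l)" and "i < q"
  shows "continuous_on UNIV (\<lambda>(t, r). cgrad q F ((W t)(i := W t i + c * of_real r)) i)"
proof -
  have "continuous_on UNIV (\<lambda>p. (W (fst p))(i := W (fst p) i + c * of_real (snd p)))"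
  proof (rule continuous_on_coordinatewise_then_product)
    fix l
    have *: "continuous_on UNIV (\<lambda>p. W (fst p) l)" for l
      using continuous_on_compose2[OF W(2)[of l] continuous_on_fst] by (auto intro: continuous_intros)
    show "continuous_on UNIV (\<lambda>p. ((W (fst p))(i := W (fst p) i + c * of_real (snd p))) l)"
      by (cases "l = i") (auto intro!: continuous_intros *)
  qed
  then have "continuous_on UNIV (\<lambda>p. cgrad q F ((W (fst p))(i := W (fst p) i + c * of_real (snd p))))"
    using W(1) \<open>i < q\<close> by (intro continuous_on_compose2[OF grad]) (auto intro: cvec_fun_upd)
  from continuous_on_product_then_coordinatewise[OF this, of i] show ?thesis
    by (simp add: case_prod_unfold)
qed

text \<open>A complex move in coordinate \<open>i\<close> is a real move followed by an imaginary
  one, and each is an instance of the two-variable rule. The two real products add up to the real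
  part of the gradient entry times \<open>cnj c\<close>.\<close>

lemma has_real_derivative_coordinate_step:
  assumes part: "\<And>w. w \<in> cvec q \<Longrightarrow> has_partials q F w"
    and grad: "continuous_on (cvec q) (cgrad q F)"
    and W: "\<And>t. W t \<in> cvec q" "\<And>l. continuous_on UNIV (\<lambda>t::real. W t l)" and "i < q"
    and der: "((\<lambda>t. F (W t)) has_real_derivative A) (at 0)"
  shows "((\<lambda>t. F ((W t)(i := W t i + of_real t * c))) has_real_derivative
           A + Re (cgrad q F (W 0) i * cnj c)) (at 0)"
proof -
  \<comment> \<open>The intermediate curve: \<open>W\<close> with only the real part of the move
    carried out.\<close>
  define V where "V t = (W t)(i := W t i + of_real (Re c * t))" for t
  have V: "V t \<in> cvec q" for t
    using W(1) \<open>i < q\<close> by (simp add: V_def cvec_fun_upd)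
  have contV: "continuous_on UNIV (\<lambda>t. V t l)" for l
    unfolding V_def by (cases "l = i") (auto intro!: continuous_intros W(2))
  \<comment> \<open>Both partial derivatives are therefore evaluated at the same point.\<close>
  have "V 0 = W 0"
    by (simp add: V_def)
  have "((\<lambda>t. F (V t)) has_real_derivative A + Re c * Re (cgrad q F (W 0) i)) (at 0)"
    unfolding V_def
    using has_real_derivative_two_variables
      [of "\<lambda>t r. F ((W t)(i := W t i + of_real r))" A
        "\<lambda>t r. Re (cgrad q F ((W t)(i := W t i + of_real r)) i)" "Re c"]
      der has_real_derivative_re_coordinate[OF part[OF cvec_fun_upd[OF W(1) \<open>i < q\<close>]] \<open>i < q\<close>]
      continuous_on_Re[OF cgrad_coordinate_perturbation_continuous[OF grad W \<open>i < q\<close>, of 1]]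
    by (simp add: case_prod_unfold)
  then have "((\<lambda>t. F ((V t)(i := V t i + \<i> * of_real (Im c * t)))) has_real_derivative
      A + Re c * Re (cgrad q F (W 0) i) + Im c * Im (cgrad q F (V 0) i)) (at 0)"
    using has_real_derivative_two_variables
      [of "\<lambda>t r. F ((V t)(i := V t i + \<i> * of_real r))" _
        "\<lambda>t r. Im (cgrad q F ((V t)(i := V t i + \<i> * of_real r)) i)" "Im c"]
      has_real_derivative_im_coordinate[OF part[OF cvec_fun_upd[OF V \<open>i < q\<close>]] \<open>i < q\<close>]
      continuous_on_Im[OF cgrad_coordinate_perturbation_continuous[OF grad V contV \<open>i < q\<close>, of \<i>]]
    by (simp add: case_prod_unfold)
  moreover have "(V t)(i := V t i + \<i> * of_real (Im c * t)) = (W t)(i := W t i + of_real t * c)" for t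
    by (auto simp: V_def fun_eq_iff complex_eq_iff)
  ultimately show ?thesis
    by (simp add: \<open>V 0 = W 0\<close> algebra_simps)
qed

text \<open>The coordinates are set in motion one at a time, by induction on the set of moving
  coordinates. The real part of \<open>cinner\<close> is the real inner product of real and
  imaginary parts, which is the usual directional derivative.\<close>

lemma has_real_derivative_direction:
  assumes part: "\<And>w. w \<in> cvec q \<Longrightarrow> has_partials q F w"
    and grad: "continuous_on (cvec q) (cgrad q F)"
    and u: "u \<in> cvec q" and d: "d \<in> cvec q"
  shows "((\<lambda>t. F (\<lambda>i. u i + of_real t * d i)) has_real_derivative
           Re (cinner {..<q} (cgrad q F u) d)) (at 0)"
proof -
  \<comment> \<open>\<open>W S\<close> moves along \<open>d\<close> only in the coordinates in
    \<open>S\<close>, so inserting \<open>i\<close> into \<open>S\<close> is one coordinate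
    step.\<close>
  define W where "W S t = (\<lambda>i. if i \<in> S then u i + of_real t * d i else u i)" for S and t :: real
  have "((\<lambda>t. F (W S t)) has_real_derivative Re (cinner S (cgrad q F u) d)) (at 0)"
    if "finite S" "S \<subseteq> {..<q}" for S
    using that
  proof (induction S rule: finite_induct)
    case empty
    then show ?case
      by (simp add: W_def cinner_def)
  next
    case (insert i S)
    have "W S t \<in> cvec q" for t
      using u d by (simp add: W_def cvec_def)
    moreover have "continuous_on UNIV (\<lambda>t. W S t l)" for l
      unfolding W_def by (cases "l \<in> S") (auto intro!: continuous_intros)
    ultimately have "((\<lambda>t. F ((W S t)(i := W S t i + of_real t * d i))) has_real_derivative
        Re (cinner S (cgrad q F u) d) + Re (cgrad q F (W S 0) i * cnj (d i))) (at 0)"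
      using insert by (intro has_real_derivative_coordinate_step[OF part grad]) auto
    moreover have "(W S t)(i := W S t i + of_real t * d i) = W (insert i S) t" for t
      using \<open>i \<notin> S\<close> by (auto simp: W_def fun_eq_iff)
    moreover have "W S 0 = u"
      by (simp add: W_def fun_eq_iff)
    ultimately show ?case
      using insert by (simp add: cinner_def add.commute)
  qed
  from this[of "{..<q}"] have
    "((\<lambda>t. F (W {..<q} t)) has_real_derivative Re (cinner {..<q} (cgrad q F u) d)) (at 0)"
    by simp
  moreover have "W {..<q} = (\<lambda>t i. u i + of_real t * d i)"
    using d by (auto simp: W_def fun_eq_iff cvec_def)
  ultimately show ?thesis
    by simp
qed

lemma deriv_ge_of_lower_cone:
  fixes h :: "real \<Rightarrow> real"
  assumes der: "(h has_real_derivative D) (at 0)" and cone: "\<And>t. h 0 - c * \<bar>t\<bar> \<le> h t"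
  shows "- c \<le> D"
proof -
  have "((\<lambda>t. (h t - h 0) / t) \<longlongrightarrow> D) (at_right 0)"
    using der by (auto simp: has_field_derivative_iff intro: tendsto_mono[OF at_le])
  moreover have "\<forall>\<^sub>F t in at_right 0. - c \<le> (h t - h 0) / t"
    using eventually_at_right_less[of 0]
  proof eventually_elim
    case (elim t)
    then show ?case
      using cone[of t] by (simp add: field_simps)
  qed
  ultimately show ?thesis
    by (rule tendsto_lowerbound) simp
qed

text \<open>The one-sided estimate applies to \<open>h\<close> and to its reflection. This takes the
  place of subgradient calculus: at a minimiser of a smooth term plus an l1 penalty, the smooth term
  lies above a cone along every real line, because the penalty is Lipschitz.\<close>

lemma abs_deriv_le_of_lower_cone:
  fixes h :: "real \<Rightarrow> real"
  assumes der: "(h has_real_derivative D) (at 0)" and cone: "\<And>t. h 0 - c * \<bar>t\<bar> \<le> h t"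
  shows "\<bar>D\<bar> \<le> c"
proof -
  have "((\<lambda>t. h (- t)) has_real_derivative - D) (at 0)"
    using der DERIV_mirror[of h D 0] by simp
  then have "- c \<le> - D"
    by (rule deriv_ge_of_lower_cone) (use cone[of "- t" for t] in simp)
  with deriv_ge_of_lower_cone[OF assms] show ?thesis
    by linarith
qed

text \<open>Once the coefficients \<open>b\<close> are below 1/2 in modulus, the recursion keeps
  \<open>v\<close> bounded. Then \<open>b k * v k\<close> tends to 0 and only \<open>a\<close>
  contributes to the limit.\<close>

lemma tendsto_perturbed_recursion:
  fixes v a b :: "nat \<Rightarrow> 'a::real_normed_field"
  assumes rec: "\<forall>\<^sub>F k in sequentially. v (Suc k) = a k + b k * v k"
    and a: "a \<longlonglongrightarrow> l" and b: "b \<longlonglongrightarrow> 0"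
  shows "v \<longlonglongrightarrow> l"
proof -
  obtain M where M: "M > 0" "\<And>k. norm (a k) \<le> M"
    using convergent_imp_Bseq[OF convergentI[OF a]] by (auto simp: Bseq_def)
  have "\<forall>\<^sub>F k in sequentially. norm (b k) < 1 / 2"
    using tendstoD[OF b, of "1 / 2"] by simp
  with rec have "\<forall>\<^sub>F k in sequentially. norm (b k) < 1 / 2 \<and> v (Suc k) = a k + b k * v k"
    by eventually_elim simp
  then obtain N where N: "\<And>k. k \<ge> N \<Longrightarrow> norm (b k) < 1 / 2 \<and> v (Suc k) = a k + b k * v k"
    by (auto simp: eventually_sequentially)
  \<comment> \<open>The bound reproduces itself: half of it plus \<open>M\<close> is at most the
    bound again.\<close>
  have "norm (v k) \<le> 2 * M + norm (v N)" if "k \<ge> N" for k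
    using that
  proof (induction k rule: dec_induct)
    case base
    then show ?case
      using \<open>M > 0\<close> by simp
  next
    case (step k)
    have "norm (v (Suc k)) \<le> norm (a k) + norm (b k) * norm (v k)"
      using N[OF \<open>N \<le> k\<close>] norm_triangle_ineq[of "a k" "b k * v k"] by (simp add: norm_mult)
    also have "\<dots> \<le> M + 1 / 2 * (2 * M + norm (v N))"
      using N[OF \<open>N \<le> k\<close>] M step.IH by (intro add_mono mult_mono) auto
    also have "\<dots> \<le> 2 * M + norm (v N)"
      by simp
    finally show ?case .
  qed
  then have "\<forall>\<^sub>F k in sequentially. norm (v k) \<le> 2 * M + norm (v N)"
    by (auto simp: eventually_sequentially)
  then have "(\<lambda>k. b k * v k) \<longlonglongrightarrow> 0"
    using b lim_null_mult_right_bounded by blast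
  with a have "(\<lambda>k. a k + b k * v k) \<longlonglongrightarrow> l + 0"
    by (rule tendsto_add)
  then have "(\<lambda>k. v (Suc k)) \<longlonglongrightarrow> l"
    using rec by (auto elim: Lim_transform_eventually simp: eq_commute)
  then show ?thesis
    by (rule LIMSEQ_imp_Suc)
qed

lemma convergent_of_summable_steps:
  fixes a :: "nat \<Rightarrow> 'a::banach"
  assumes "summable (\<lambda>k. norm (a (Suc k) - a k))"
  shows "convergent a"
proof -
  have "convergent (\<lambda>k. \<Sum>i<k. a (Suc i) - a i)"
    using summable_norm_cancel[OF assms] by (simp add: summable_iff_convergent)
  then have "convergent (\<lambda>k. a 0 + (a k - a 0))"
    unfolding sum_lessThan_telescope by (intro convergent_add convergent_const)
  then show ?thesis
    by simp
qed

lemma C1_on_prod_has_real_derivative_fst: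
  assumes "C1_on_prod p q \<phi>" and "u \<in> cvec p" "d \<in> cvec p" "w \<in> cvec q"
  shows "((\<lambda>t. \<phi> (\<lambda>i. u i + of_real t * d i) w) has_real_derivative
           Re (cinner {..<p} (cgrad p (\<lambda>u. \<phi> u w) u) d)) (at 0)"
proof (rule has_real_derivative_direction)
  have "continuous_on (cvec p \<times> cvec q) (\<lambda>(u, w). cgrad p (\<lambda>u. \<phi> u w) u)"
    using assms by (simp add: C1_on_prod_def)
  from continuous_on_compose2[OF this, of "cvec p" "\<lambda>u. (u, w)"] assms
  show "continuous_on (cvec p) (cgrad p (\<lambda>u. \<phi> u w))"
    by (simp add: continuous_on_Pair image_subset_iff)
qed (use assms in \<open>auto simp: C1_on_prod_def\<close>)

lemma C1_on_prod_has_real_derivative_snd: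
  assumes "C1_on_prod p q \<phi>" and "u \<in> cvec p" "w \<in> cvec q" "d \<in> cvec q"
  shows "((\<lambda>t. \<phi> u (\<lambda>i. w i + of_real t * d i)) has_real_derivative
           Re (cinner {..<q} (cgrad q (\<phi> u) w) d)) (at 0)"
proof (rule has_real_derivative_direction)
  have "continuous_on (cvec p \<times> cvec q) (\<lambda>(u, w). cgrad q (\<phi> u) w)"
    using assms by (simp add: C1_on_prod_def)
  from continuous_on_compose2[OF this, of "cvec q" "\<lambda>w. (u, w)"] assms
  show "continuous_on (cvec q) (cgrad q (\<phi> u))"
    by (simp add: continuous_on_Pair image_subset_iff)
qed (use assms in \<open>auto simp: C1_on_prod_def\<close>)

lemma C1_on_prod_cgrad_tendsto:
  assumes "C1_on_prod p q \<phi>"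
    and "(u \<longlongrightarrow> u') F" "(w \<longlongrightarrow> w') F"
    and "\<And>k. u k \<in> cvec p" "\<And>k. w k \<in> cvec q" "u' \<in> cvec p" "w' \<in> cvec q"
  shows "((\<lambda>k. cgrad p (\<lambda>u. \<phi> u (w k)) (u k) i) \<longlongrightarrow> cgrad p (\<lambda>u. \<phi> u w') u' i) F"
    and "((\<lambda>k. cgrad q (\<phi> (u k)) (w k) i) \<longlongrightarrow> cgrad q (\<phi> u') w' i) F"
proof -
  have lim: "((\<lambda>k. (u k, w k)) \<longlongrightarrow> (u', w')) F"
    using assms by (intro tendsto_Pair)
  have "continuous_on (cvec p \<times> cvec q) (\<lambda>(u, w). cgrad p (\<lambda>u. \<phi> u w) u)"
    using assms by (simp add: C1_on_prod_def)
  from continuous_on_tendsto_compose[OF this lim] assms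
  show "((\<lambda>k. cgrad p (\<lambda>u. \<phi> u (w k)) (u k) i) \<longlongrightarrow> cgrad p (\<lambda>u. \<phi> u w') u' i) F"
    by (simp add: tendsto_fun_iff)
  have "continuous_on (cvec p \<times> cvec q) (\<lambda>(u, w). cgrad q (\<phi> u) w)"
    using assms by (simp add: C1_on_prod_def)
  from continuous_on_tendsto_compose[OF this lim] assms
  show "((\<lambda>k. cgrad q (\<phi> (u k)) (w k) i) \<longlongrightarrow> cgrad q (\<phi> u') w' i) F"
    by (simp add: tendsto_fun_iff)
qed

text \<open>Used to discard the summands of the objective that do not involve the block being
  differentiated. The constant cancels in every difference quotient, so the two \<open>deriv\<close>
  terms describe the same number.\<close>

lemma cgrad_add_const: "cgrad q (\<lambda>w. F w + c) = cgrad q F"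
proof -
  have "deriv (\<lambda>t. h t + c) 0 = deriv h 0" for h :: "real \<Rightarrow> real"
    by (simp add: deriv_def has_field_derivative_iff)
  from this[of "re_slice F _ _"] this[of "im_slice F _ _"] show ?thesis
    by (simp add: cgrad_def fun_eq_iff re_slice_def[abs_def] im_slice_def[abs_def])
qed

lemma cgrad_sum:
  assumes "\<And>j. j \<in> A \<Longrightarrow> has_partials q (F j) w"
  shows "cgrad q (\<lambda>w. \<Sum>j\<in>A. F j w) w i = (\<Sum>j\<in>A. cgrad q (F j) w i)"
proof (cases "i < q")
  case True
  have sum: "deriv (\<lambda>t. \<Sum>j\<in>A. h j t) 0 = (\<Sum>j\<in>A. deriv (h j) 0)"
    if "\<And>j. j \<in> A \<Longrightarrow> h j field_differentiable (at 0)" for h :: "_ \<Rightarrow> real \<Rightarrow> real"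
    by (rule DERIV_imp_deriv, rule DERIV_sum) (use that in \<open>simp add: DERIV_deriv_iff_field_differentiable\<close>)
  have "re_slice (\<lambda>w. \<Sum>j\<in>A. F j w) w i = (\<lambda>t. \<Sum>j\<in>A. re_slice (F j) w i t)"
    "im_slice (\<lambda>w. \<Sum>j\<in>A. F j w) w i = (\<lambda>t. \<Sum>j\<in>A. im_slice (F j) w i t)"
    by (simp_all add: re_slice_def im_slice_def fun_eq_iff)
  with True assms sum[of "\<lambda>j. re_slice (F j) w i"] sum[of "\<lambda>j. im_slice (F j) w i"] show ?thesis
    by (simp add: cgrad_def has_partials_def sum.distrib sum_distrib_left)
qed (simp add: cgrad_def)

lemma l1_norm_nonneg: "0 \<le> l1_norm I w"
  by (simp add: l1_norm_def sum_nonneg)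

lemma l1_norm_mult: "l1_norm I (\<lambda>i. c * w i) = cmod c * l1_norm I w"
  by (simp add: l1_norm_def norm_mult sum_distrib_left)

lemma norm_le_l1_norm: "finite I \<Longrightarrow> i \<in> I \<Longrightarrow> cmod (w i) \<le> l1_norm I w"
  unfolding l1_norm_def by (rule member_le_sum) auto

lemma l1_norm_triangle: "l1_norm I (\<lambda>i. u i + w i) \<le> l1_norm I u + l1_norm I w"
  by (simp add: l1_norm_def norm_triangle_ineq sum_mono flip: sum.distrib)

lemma l2_norm_power2: "(l2_norm I w)\<^sup>2 = Re (cinner I w w)"
  by (simp add: l2_norm_def cinner_def L2_set_def sum_nonneg flip: complex_norm_square)

text \<open>Compare \<open>s\<close> with \<open>s + t\<close> for real \<open>t\<close>: the point
  moves by \<open>t\<close> along \<open>v\<close>, and the penalty grows by at most \<gamma> times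
  the modulus of \<open>t\<close> times the l1 norm of \<open>v\<close>. This is the lower cone
  whose slope bounds the derivative along \<open>v\<close>.\<close>

lemma line_search_stationarity:
  assumes C1: "C1_on_prod p q \<phi>" and x: "x \<in> cvec p" and v: "v \<in> cvec p" and w: "w \<in> cvec q"
    and "\<gamma> \<ge> 0"
    and min: "is_arg_min (\<lambda>t. \<phi> (\<lambda>i. x i + t * v i) w + \<gamma> * l1_norm {..<p} (\<lambda>i. t * v i))
                (\<lambda>t. True) s"
  shows "\<bar>Re (cinner {..<p} (cgrad p (\<lambda>u. \<phi> u w) (\<lambda>i. x i + s * v i)) v)\<bar> \<le> \<gamma> * l1_norm {..<p} v"
proof (rule abs_deriv_le_of_lower_cone)
  let ?u = "\<lambda>i. x i + s * v i" and ?N = "l1_norm {..<p} v"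
  have "?u \<in> cvec p"
    using x v by (simp add: cvec_def)
  then show "((\<lambda>t. \<phi> (\<lambda>i. ?u i + of_real t * v i) w) has_real_derivative
      Re (cinner {..<p} (cgrad p (\<lambda>u. \<phi> u w) ?u) v)) (at 0)"
    using C1_on_prod_has_real_derivative_fst[OF C1 _ v w] by blast
  fix t :: real
  have "\<phi> ?u w + \<gamma> * (cmod s * ?N)
      \<le> \<phi> (\<lambda>i. x i + (s + of_real t) * v i) w + \<gamma> * (cmod (s + of_real t) * ?N)"
    using min by (simp add: is_arg_min_linorder l1_norm_mult)
  moreover have "\<gamma> * (cmod (s + of_real t) * ?N) \<le> \<gamma> * ((cmod s + \<bar>t\<bar>) * ?N)"
    using \<open>\<gamma> \<ge> 0\<close> l1_norm_nonneg norm_triangle_ineq[of s "of_real t"]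
    by (intro mult_left_mono mult_right_mono) auto
  ultimately show "\<phi> (\<lambda>i. ?u i + of_real 0 * v i) w - \<gamma> * ?N * \<bar>t\<bar> \<le> \<phi> (\<lambda>i. ?u i + of_real t * v i) w"
    by (simp add: algebra_simps)
qed

text \<open>The cone argument is run along a direction supported on coordinate \<open>i\<close>
  alone, which isolates one entry of the gradient.\<close>

lemma proximal_step_stationarity:
  assumes C1: "\<And>j. j \<in> A \<Longrightarrow> C1_on_prod (p j) q (\<phi> j)" and u: "\<And>j. j \<in> A \<Longrightarrow> u j \<in> cvec (p j)"
    and "\<beta> \<ge> 0" and "i < q"
    and min: "is_arg_min (\<lambda>w. (\<Sum>j\<in>A. \<phi> j (u j) w) + \<beta> * l1_norm {..<q} (\<lambda>i. w i - w\<^sub>0 i))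
                (\<lambda>w. w \<in> cvec q) w"
  shows "cmod (\<Sum>j\<in>A. cgrad q (\<phi> j (u j)) w i) \<le> \<beta>"
proof -
  define G where "G = (\<Sum>j\<in>A. cgrad q (\<phi> j (u j)) w i)"
  \<comment> \<open>With the gradient entry \<open>G\<close> itself as direction, the derivative is
    the square of its modulus while the penalty has slope \<beta> times its modulus; one factor then
    cancels.\<close>
  define d where "d l = (if l = i then G else 0)" for l
  have w: "w \<in> cvec q" and d: "d \<in> cvec q"
    using min \<open>i < q\<close> by (auto simp: is_arg_min_def d_def cvec_def)
  have "\<bar>(cmod G)\<^sup>2\<bar> \<le> \<beta> * cmod G"
  proof (rule abs_deriv_le_of_lower_cone)
    have "(\<Sum>j\<in>A. Re (cinner {..<q} (cgrad q (\<phi> j (u j)) w) d)) = (cmod G)\<^sup>2"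
    proof -
      have "cinner {..<q} (cgrad q (\<phi> j (u j)) w) d = cgrad q (\<phi> j (u j)) w i * cnj G" for j
        using \<open>i < q\<close> by (simp add: cinner_def d_def if_distrib[of cnj] if_distrib[of "(*) _"] cong: if_cong)
      then have "(\<Sum>j\<in>A. cinner {..<q} (cgrad q (\<phi> j (u j)) w) d) = G * cnj G"
        by (simp add: G_def sum_distrib_right)
      then show ?thesis
        by (simp flip: Re_sum complex_norm_square)
    qed
    then show "((\<lambda>t. \<Sum>j\<in>A. \<phi> j (u j) (\<lambda>l. w l + of_real t * d l)) has_real_derivative (cmod G)\<^sup>2) (at 0)"
      using DERIV_sum[OF C1_on_prod_has_real_derivative_snd[OF C1 u w d]] by fastforce
    fix t :: real
    let ?w = "\<lambda>l. w l + of_real t * d l"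
    have "?w \<in> cvec q"
      using w d by (simp add: cvec_def)
    then have "(\<Sum>j\<in>A. \<phi> j (u j) w) + \<beta> * l1_norm {..<q} (\<lambda>i. w i - w\<^sub>0 i)
        \<le> (\<Sum>j\<in>A. \<phi> j (u j) ?w) + \<beta> * l1_norm {..<q} (\<lambda>i. ?w i - w\<^sub>0 i)"
      using min by (simp add: is_arg_min_linorder)
    moreover have "l1_norm {..<q} (\<lambda>i. ?w i - w\<^sub>0 i)
        \<le> l1_norm {..<q} (\<lambda>i. w i - w\<^sub>0 i) + \<bar>t\<bar> * cmod G"
    proof -
      have "l1_norm {..<q} d = cmod G"
        using \<open>i < q\<close> by (simp add: l1_norm_def d_def if_distrib[of cmod] cong: if_cong)
      with l1_norm_triangle[of "{..<q}" "\<lambda>i. w i - w\<^sub>0 i" "\<lambda>i. of_real t * d i"] show ?thesis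
        by (simp add: l1_norm_mult algebra_simps)
    qed
    ultimately show "(\<Sum>j\<in>A. \<phi> j (u j) (\<lambda>l. w l + of_real 0 * d l)) - \<beta> * cmod G * \<bar>t\<bar>
        \<le> (\<Sum>j\<in>A. \<phi> j (u j) ?w)"
      using mult_left_mono[OF _ \<open>\<beta> \<ge> 0\<close>] by (fastforce simp: algebra_simps)
  qed
  then have "cmod G * cmod G \<le> \<beta> * cmod G"
    by (simp add: power2_eq_square)
  then show ?thesis
    using \<open>\<beta> \<ge> 0\<close> by (cases "G = 0") (auto simp: G_def)
qed

text \<open>The coefficient is of Polak-Ribiere type: its numerator contains the difference of
  consecutive gradients, which tends to 0, while its denominator tends to a nonzero number. Each
  coordinate of \<open>v\<close> thus obeys a recursion with vanishing perturbation.\<close>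

lemma conjugate_direction_tendsto:
  assumes rec: "\<And>k. v (Suc k) =
          (if g k \<noteq> (\<lambda>i. 0)
           then (\<lambda>i. g (Suc k) i +
                  of_real (Re (cinner {..<q} (g (Suc k)) (\<lambda>l. g (Suc k) l - g k l))
                           / (l2_norm {..<q} (g k))\<^sup>2) * v k i)
           else g (Suc k))"
    and g: "\<And>i. (\<lambda>k. g k i) \<longlonglongrightarrow> G i" and nonzero: "l2_norm {..<q} G \<noteq> 0"
  shows "(\<lambda>k. v k i) \<longlonglongrightarrow> G i"
proof (rule tendsto_perturbed_recursion)
  define b where "b k = complex_of_real
    (Re (cinner {..<q} (g (Suc k)) (\<lambda>l. g (Suc k) l - g k l)) / (l2_norm {..<q} (g k))\<^sup>2)" for k
  have g_Suc: "(\<lambda>k. g (Suc k) i) \<longlonglongrightarrow> G i" for i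
    by (rule LIMSEQ_Suc[OF g])
  then show "(\<lambda>k. g (Suc k) i) \<longlonglongrightarrow> G i" .
  have "b \<longlonglongrightarrow> of_real (Re (cinner {..<q} G (\<lambda>l. G l - G l)) / (l2_norm {..<q} G)\<^sup>2)"
    unfolding b_def cinner_def l2_norm_def L2_set_def
    using nonzero by (intro tendsto_intros g g_Suc) (simp add: l2_norm_def L2_set_def)
  then show "b \<longlonglongrightarrow> 0"
    by (simp add: cinner_def)
  \<comment> \<open>A nonzero coordinate of the limit rules out the restart branch of the recursion
    from some index on.\<close>
  obtain l where "G l \<noteq> 0"
    using nonzero by (fastforce simp: l2_norm_def L2_set_def)
  then have "\<forall>\<^sub>F k in sequentially. g k l \<noteq> 0"
    by (rule tendsto_imp_eventually_ne[OF g])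
  then show "\<forall>\<^sub>F k in sequentially. v (Suc k) i = g (Suc k) i + b k * v k i"
    by eventually_elim (auto simp: rec b_def fun_eq_iff)
qed

text \<open>The values of \<Phi> are nonincreasing and bounded below, so their drops form a
  convergent telescoping series, which dominates \<open>c\<close> times the step lengths.\<close>

lemma convergent_of_sufficient_decrease:
  fixes a :: "nat \<Rightarrow> 'a::banach" and \<Phi> :: "nat \<Rightarrow> real"
  assumes "c > 0" and decrease: "\<And>k. c * norm (a (Suc k) - a k) \<le> \<Phi> k - \<Phi> (Suc k)"
    and bound: "\<And>k. B \<le> \<Phi> k"
  shows "convergent a"
proof (rule convergent_of_summable_steps)
  have "\<Phi> (Suc k) \<le> \<Phi> k" for k
    using decrease[of k] \<open>c > 0\<close> by (smt (verit) mult_nonneg_nonneg norm_ge_zero)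
  then obtain l where "\<Phi> \<longlonglongrightarrow> l"
    using decseq_convergent[of \<Phi> B] bound by (metis decseq_Suc_iff)
  then have "summable (\<lambda>k. inverse c * (\<Phi> k - \<Phi> (Suc k)))"
    by (intro summable_mult telescope_summable')
  then show "summable (\<lambda>k. norm (a (Suc k) - a k))"
    by (rule summable_comparison_test') (use decrease \<open>c > 0\<close> in \<open>simp add: field_simps\<close>)
qed

theorem theorem5p4:
  fixes J m :: nat and n :: "nat \<Rightarrow> nat"
    and \<psi> :: "nat \<Rightarrow> (nat \<Rightarrow> complex) \<Rightarrow> (nat \<Rightarrow> complex) \<Rightarrow> real"
    and \<gamma> \<beta> :: real
    and x :: "nat \<Rightarrow> nat \<Rightarrow> nat \<Rightarrow> complex" and y :: "nat \<Rightarrow> nat \<Rightarrow> complex"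
    and s :: "nat \<Rightarrow> nat \<Rightarrow> complex" and g v :: "nat \<Rightarrow> nat \<Rightarrow> nat \<Rightarrow> complex"
  assumes "J > 0" and "m > 0" and "\<And>j. j \<in> {1..J} \<Longrightarrow> n j > 0"
    and C1: "\<And>j. j \<in> {1..J} \<Longrightarrow> C1_on_prod (n j) m (\<psi> j)"
    and bounded_below: "bdd_below ((\<lambda>(x, y). total_obj J \<psi> x y) ` (blocks J n \<times> cvec m))"
    and "\<gamma> > 0" and "\<beta> > 0"
    and x_in: "\<And>k. x k \<in> blocks J n" and y_in: "\<And>k. y k \<in> cvec m"
    and g: "\<And>k j. j \<in> {1..J} \<Longrightarrow> g k j = cgrad (n j) (\<lambda>u. \<psi> j u (y k)) (x k j)"
    and v_0: "\<And>j. j \<in> {1..J} \<Longrightarrow> v 0 j = g 0 j"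
    and v_Suc: "\<And>k j. j \<in> {1..J} \<Longrightarrow> v (Suc k) j =
          (if g k j \<noteq> (\<lambda>i. 0)
           then (\<lambda>i. g (Suc k) j i +
                  of_real (Re (cinner {..<n j} (g (Suc k) j) (\<lambda>l. g (Suc k) j l - g k j l))
                           / (l2_norm {..<n j} (g k j))\<^sup>2) * v k j i)
           else g (Suc k) j)"
    and s_min: "\<And>k j. j \<in> {1..J} \<Longrightarrow>
          is_arg_min (\<lambda>t. \<psi> j (\<lambda>i. x k j i + t * v k j i) (y k)
                          + \<gamma> * l1_norm {..<n j} (\<lambda>i. t * v k j i))
                     (\<lambda>t. True) (s k j)"
    and x_Suc: "\<And>k j. j \<in> {1..J} \<Longrightarrow> x (Suc k) j = (\<lambda>i. x k j i + s k j * v k j i)"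
    and y_min: "\<And>k. is_arg_min (\<lambda>w. (\<Sum>j=1..J. \<psi> j (x (Suc k) j) w)
                                   + \<beta> * l1_norm {..<m} (\<lambda>i. w i - y k i))
                              (\<lambda>w. w \<in> cvec m) (y (Suc k))"
  shows "(\<exists>z \<in> blocks J n \<times> cvec m. (\<lambda>k. (x k, y k)) \<longlonglongrightarrow> z) \<and>
         (\<forall>L \<epsilon> xs ys.
            L \<ge> Max ((\<lambda>j. sqrt (real (n j))) ` {1..J}) \<longrightarrow>
            (\<forall>j\<in>{1..J}. \<forall>\<xi>\<in>cvec (n j). l1_norm {..<n j} \<xi> \<le> L * l2_norm {..<n j} \<xi>) \<longrightarrow>
            \<epsilon> = max (\<gamma> * L) \<beta> \<longrightarrow>
            (\<lambda>k. (x k, y k)) \<longlonglongrightarrow> (xs, ys) \<longrightarrow>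
            linf_norm (full_index J n m) (full_grad n m (total_obj J \<psi>) xs ys) \<le> \<epsilon>)"
proof (intro conjI allI impI)

  \<comment> \<open>Objective values and the spaces of the iterates\<close>
  define \<Phi> where "\<Phi> k = total_obj J \<psi> (x k) (y k)" for k
  have xj: "x k j \<in> cvec (n j)" if "j \<in> {1..J}" for k j
    using x_in[of k] that by (auto simp: blocks_def)
  have gj: "g k j \<in> cvec (n j)" if "j \<in> {1..J}" for k j
    using g[OF that] by (simp add: cgrad_in_cvec)
  have vj: "v k j \<in> cvec (n j)" if "j \<in> {1..J}" for k j
  proof (induction k)
    case 0
    then show ?case
      using v_0 gj that by simp
  next
    case (Suc k)
    then show ?case
      using v_Suc[OF that] gj[OF that, of "Suc k"] by (simp add: cvec_def)
  qed

  \<comment> \<open>Sufficient decrease and coordinatewise convergence\<close>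
  have x_decrease: "\<psi> j (x (Suc k) j) (y k) + \<gamma> * l1_norm {..<n j} (\<lambda>i. x (Suc k) j i - x k j i)
      \<le> \<psi> j (x k j) (y k)" if "j \<in> {1..J}" for k j
    using s_min[OF that, of k] x_Suc[OF that, of k]
    by (auto simp: is_arg_min_linorder l1_norm_mult dest!: spec[of _ 0])
  \<comment> \<open>All block steps use the same \<open>y k\<close>, and block \<open>j\<close>
    enters only the summand \<open>\<psi> j\<close>, so their decreases add up before the
    \<open>y\<close> step is taken.\<close>
  have decrease: "\<gamma> * (\<Sum>j=1..J. l1_norm {..<n j} (\<lambda>i. x (Suc k) j i - x k j i))
      + \<beta> * l1_norm {..<m} (\<lambda>i. y (Suc k) i - y k i) \<le> \<Phi> k - \<Phi> (Suc k)" for k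
  proof -
    have "(\<Sum>j=1..J. \<psi> j (x (Suc k) j) (y k) + \<gamma> * l1_norm {..<n j} (\<lambda>i. x (Suc k) j i - x k j i))
        \<le> \<Phi> k"
      unfolding \<Phi>_def total_obj_def by (intro sum_mono x_decrease)
    moreover have "\<Phi> (Suc k) + \<beta> * l1_norm {..<m} (\<lambda>i. y (Suc k) i - y k i)
        \<le> (\<Sum>j=1..J. \<psi> j (x (Suc k) j) (y k))"
      using y_min[of k] y_in[of k]
      by (auto simp: is_arg_min_linorder \<Phi>_def total_obj_def l1_norm_def dest!: spec[of _ "y k"])
    ultimately show ?thesis
      by (simp add: sum.distrib sum_distrib_left)
  qed
  obtain B where B: "\<And>k. B \<le> \<Phi> k"
    using bounded_below x_in y_in by (force simp: bdd_below_def \<Phi>_def)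
  have x_conv: "convergent (\<lambda>k. x k j i)" if "j \<in> {1..J}" for j i
  proof (cases "i < n j")
    case True
    \<comment> \<open>One coordinate's step is dominated by the total decrease, so the scalar
      criterion suffices.\<close>
    have "\<gamma> * cmod (x (Suc k) j i - x k j i) \<le> \<Phi> k - \<Phi> (Suc k)" for k
    proof -
      have "cmod (x (Suc k) j i - x k j i) \<le> l1_norm {..<n j} (\<lambda>i. x (Suc k) j i - x k j i)"
        using True norm_le_l1_norm[of "{..<n j}" i "\<lambda>i. x (Suc k) j i - x k j i"] by simp
      also have "\<dots> \<le> (\<Sum>j=1..J. l1_norm {..<n j} (\<lambda>i. x (Suc k) j i - x k j i))"
        using that by (intro member_le_sum l1_norm_nonneg) auto
      finally have "\<gamma> * cmod (x (Suc k) j i - x k j i)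
          \<le> \<gamma> * (\<Sum>j=1..J. l1_norm {..<n j} (\<lambda>i. x (Suc k) j i - x k j i))"
        using \<open>\<gamma> > 0\<close> by simp
      moreover have "0 \<le> \<beta> * l1_norm {..<m} (\<lambda>i. y (Suc k) i - y k i)"
        using \<open>\<beta> > 0\<close> by (simp add: l1_norm_nonneg)
      ultimately show ?thesis
        using decrease[of k] by linarith
    qed
    then show ?thesis
      by (rule convergent_of_sufficient_decrease[where \<Phi> = \<Phi>, OF \<open>\<gamma> > 0\<close> _ B])
  next
    case False
    then have "(\<lambda>k. x k j i) = (\<lambda>k. 0)"
      using xj[OF that] by (auto simp: cvec_def)
    then show ?thesis
      by (simp add: convergent_const)
  qed
  have y_conv: "convergent (\<lambda>k. y k i)" for i
  proof (cases "i < m")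
    case True
    have "\<beta> * cmod (y (Suc k) i - y k i) \<le> \<Phi> k - \<Phi> (Suc k)" for k
    proof -
      have "\<beta> * cmod (y (Suc k) i - y k i) \<le> \<beta> * l1_norm {..<m} (\<lambda>i. y (Suc k) i - y k i)"
        using True norm_le_l1_norm[of "{..<m}" i "\<lambda>i. y (Suc k) i - y k i"] \<open>\<beta> > 0\<close> by simp
      moreover have "0 \<le> \<gamma> * (\<Sum>j=1..J. l1_norm {..<n j} (\<lambda>i. x (Suc k) j i - x k j i))"
        using \<open>\<gamma> > 0\<close> by (simp add: sum_nonneg l1_norm_nonneg)
      ultimately show ?thesis
        using decrease[of k] by linarith
    qed
    then show ?thesis
      by (rule convergent_of_sufficient_decrease[where \<Phi> = \<Phi>, OF \<open>\<beta> > 0\<close> _ B])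
  next
    case False
    then have "(\<lambda>k. y k i) = (\<lambda>k. 0)"
      using y_in by (auto simp: cvec_def)
    then show ?thesis
      by (simp add: convergent_const)
  qed

  \<comment> \<open>Limits in the product space\<close>
  have limit_in: "xs \<in> blocks J n \<and> ys \<in> cvec m"
    if "x \<longlonglongrightarrow> xs" "y \<longlonglongrightarrow> ys" for xs ys
  proof -
    have limx: "(\<lambda>k. x k j i) \<longlonglongrightarrow> xs j i" and limy: "(\<lambda>k. y k i) \<longlonglongrightarrow> ys i" for j i
      using that by (simp_all add: tendsto_fun_iff)
    have "xs j i = 0" if "j \<in> {1..J}" "n j \<le> i" for j i
      using limx[of j i] xj[OF that(1)] that(2) by (simp add: cvec_def LIMSEQ_const_iff)
    \<comment> \<open>Blocks outside the index range are constantly \<open>undefined\<close> by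
      extensionality, and so is their limit.\<close>
    moreover have "xs j = undefined" if "j \<notin> {1..J}" for j
    proof -
      have "x k j = undefined" for k
        using x_in[of k] that by (auto simp: blocks_def PiE_def extensional_def)
      then show ?thesis
        using limx[of j] by (simp add: LIMSEQ_const_iff fun_eq_iff)
    qed
    moreover have "ys i = 0" if "m \<le> i" for i
      using limy[of i] y_in that by (simp add: cvec_def LIMSEQ_const_iff)
    ultimately show ?thesis
      by (auto simp: blocks_def cvec_def PiE_iff extensional_def)
  qed

  show "\<exists>z \<in> blocks J n \<times> cvec m. (\<lambda>k. (x k, y k)) \<longlonglongrightarrow> z"
  proof -
    have "convergent (\<lambda>k. x k j i)" for j i
    proof (cases "j \<in> {1..J}")
      case False
      then have "(\<lambda>k. x k j i) = (\<lambda>k. undefined i)"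
        using x_in by (auto simp: blocks_def PiE_def extensional_def)
      then show ?thesis
        by (simp add: convergent_const)
    qed (rule x_conv)
    then obtain xs where "\<And>j i. (\<lambda>k. x k j i) \<longlonglongrightarrow> xs j i"
      unfolding convergent_def by metis
    moreover obtain ys where "\<And>i. (\<lambda>k. y k i) \<longlonglongrightarrow> ys i"
      using y_conv unfolding convergent_def by metis
    ultimately have lims: "x \<longlonglongrightarrow> xs" "y \<longlonglongrightarrow> ys"
      by (simp_all add: tendsto_fun_iff)
    with limit_in show ?thesis
      by (intro bexI[of _ "(xs, ys)"] tendsto_Pair) auto
  qed

  fix L \<epsilon> :: real and xs ys
  assume L: "L \<ge> Max ((\<lambda>j. sqrt (real (n j))) ` {1..J})"
    and norms: "\<forall>j\<in>{1..J}. \<forall>\<xi>\<in>cvec (n j). l1_norm {..<n j} \<xi> \<le> L * l2_norm {..<n j} \<xi>"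
    and \<epsilon>: "\<epsilon> = max (\<gamma> * L) \<beta>" and lim: "(\<lambda>k. (x k, y k)) \<longlonglongrightarrow> (xs, ys)"
  have x_lim: "x \<longlonglongrightarrow> xs" and y_lim: "y \<longlonglongrightarrow> ys"
    using tendsto_fst[OF lim] tendsto_snd[OF lim] by simp_all
  have xj_lim: "(\<lambda>k. x k j) \<longlonglongrightarrow> xs j" for j
    using x_lim by (simp add: tendsto_fun_iff)
  have xs: "xs j \<in> cvec (n j)" if "j \<in> {1..J}" for j
    using limit_in[OF x_lim y_lim] that by (auto simp: blocks_def)
  have ys: "ys \<in> cvec m"
    using limit_in[OF x_lim y_lim] by blast

  \<comment> \<open>Gradient bound in the blocks of \<open>xs\<close>\<close>
  have x_bound: "cmod (cgrad (n j) (\<lambda>u. \<psi> j u ys) (xs j) i) \<le> \<gamma> * L"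
    if j: "j \<in> {1..J}" and "i < n j" for j i
  proof -
    define G where "G = cgrad (n j) (\<lambda>u. \<psi> j u ys) (xs j)"
    have G: "G \<in> cvec (n j)"
      by (simp add: G_def cgrad_in_cvec)
    have "l2_norm {..<n j} G \<le> \<gamma> * L"
    proof (cases "l2_norm {..<n j} G = 0")
      case True
      \<comment> \<open>For a vanishing gradient the claim reduces to \<open>0 \<le> L\<close>,
        which follows from this lower bound on \<open>L\<close>.\<close>
      have "sqrt (real (n j)) \<le> L"
        using L j by (auto intro: order_trans[OF Max_ge])
      then have "0 \<le> L"
        by (rule order_trans[rotated]) simp
      with True \<open>\<gamma> > 0\<close> show ?thesis
        by simp
    next
      case False
      have g_lim: "(\<lambda>k. g k j l) \<longlonglongrightarrow> G l" for l
        using C1_on_prod_cgrad_tendsto(1)[OF C1[OF j] xj_lim y_lim xj[OF j] y_in xs[OF j] ys]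
        by (simp add: g[OF j] G_def)
      have v_lim: "(\<lambda>k. v k j l) \<longlonglongrightarrow> G l" for l
        using conjugate_direction_tendsto[of "\<lambda>k. v k j" "\<lambda>k. g k j", OF v_Suc[OF j] g_lim False] .
      \<comment> \<open>Optimality of the line search concerns the mixed point with the new
        \<open>x\<close> and the old \<open>y\<close>, whose gradient is neither
        \<open>g k j\<close> nor \<open>g (Suc k) j\<close> but has the same limit.\<close>
      have new_lim: "(\<lambda>k. cgrad (n j) (\<lambda>u. \<psi> j u (y k)) (x (Suc k) j) l) \<longlonglongrightarrow> G l" for l
        using C1_on_prod_cgrad_tendsto(1)[OF C1[OF j] LIMSEQ_Suc[OF xj_lim] y_lim xj[OF j] y_in xs[OF j] ys]
        by (simp add: G_def)
      have "\<bar>Re (cinner {..<n j} (cgrad (n j) (\<lambda>u. \<psi> j u (y k)) (x (Suc k) j)) (v k j))\<bar>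
          \<le> \<gamma> * l1_norm {..<n j} (v k j)" for k
        using line_search_stationarity[OF C1[OF j] xj[OF j] vj[OF j] y_in _ s_min[OF j]] \<open>\<gamma> > 0\<close>
        by (simp add: x_Suc[OF j])
      moreover have "(\<lambda>k. \<bar>Re (cinner {..<n j} (cgrad (n j) (\<lambda>u. \<psi> j u (y k)) (x (Suc k) j)) (v k j))\<bar>)
          \<longlonglongrightarrow> \<bar>Re (cinner {..<n j} G G)\<bar>"
        unfolding cinner_def by (intro tendsto_intros new_lim v_lim)
      moreover have "(\<lambda>k. \<gamma> * l1_norm {..<n j} (v k j)) \<longlonglongrightarrow> \<gamma> * l1_norm {..<n j} G"
        unfolding l1_norm_def by (intro tendsto_intros v_lim)
      ultimately have "\<bar>Re (cinner {..<n j} G G)\<bar> \<le> \<gamma> * l1_norm {..<n j} G"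
        by (intro LIMSEQ_le) auto
      also have "\<dots> \<le> \<gamma> * (L * l2_norm {..<n j} G)"
        using norms j G \<open>\<gamma> > 0\<close> by simp
      finally have "l2_norm {..<n j} G * l2_norm {..<n j} G \<le> (\<gamma> * L) * l2_norm {..<n j} G"
        by (simp add: power2_eq_square flip: l2_norm_power2)
      moreover have "l2_norm {..<n j} G > 0"
        using False by (simp add: l2_norm_def order_less_le)
      ultimately show ?thesis
        by simp
    qed
    \<comment> \<open>The l2 bound on the whole block yields the bound on each entry.\<close>
    moreover have "cmod (G i) \<le> l2_norm {..<n j} G"
      unfolding l2_norm_def using \<open>i < n j\<close> by (intro member_le_L2_set) auto
    ultimately show ?thesis
      by (simp add: G_def)
  qed

  \<comment> \<open>Gradient bound in \<open>ys\<close>\<close>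
  have y_bound: "cmod (\<Sum>j=1..J. cgrad m (\<psi> j (xs j)) ys i) \<le> \<beta>" if "i < m" for i
  proof -
    have "(\<lambda>k. \<Sum>j=1..J. cgrad m (\<psi> j (x (Suc k) j)) (y (Suc k)) i)
        \<longlonglongrightarrow> (\<Sum>j=1..J. cgrad m (\<psi> j (xs j)) ys i)"
      \<comment> \<open>Here optimality holds at the new \<open>x\<close> and the new
        \<open>y\<close>, so both sequences are shifted by one.\<close>
      using C1_on_prod_cgrad_tendsto(2)[OF C1 LIMSEQ_Suc[OF xj_lim] LIMSEQ_Suc[OF y_lim] xj y_in xs ys]
      by (intro tendsto_sum) blast
    from tendsto_norm[OF this] show ?thesis
      by (rule LIMSEQ_le_const2)
        (use proximal_step_stationarity[OF C1 xj _ that y_min] \<open>\<beta> > 0\<close> in auto)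
  qed

  \<comment> \<open>Assembling the full gradient\<close>
  have x_grad: "full_grad n m (total_obj J \<psi>) xs ys (Inl (j, i)) = cgrad (n j) (\<lambda>u. \<psi> j u ys) (xs j) i"
    if "j \<in> {1..J}" for j i
  proof -
    have "total_obj J \<psi> (xs(j := u)) ys = \<psi> j u ys + (\<Sum>l\<in>{1..J} - {j}. \<psi> l (xs l) ys)" for u
      using that by (simp add: total_obj_def sum.remove[of _ j])
    then show ?thesis
      by (simp add: full_grad_def cgrad_add_const)
  qed
  have y_grad: "full_grad n m (total_obj J \<psi>) xs ys (Inr i) = (\<Sum>j=1..J. cgrad m (\<psi> j (xs j)) ys i)" for i
    unfolding full_grad_def total_obj_def sum.case
    by (rule cgrad_sum) (use C1 xs ys in \<open>auto simp: C1_on_prod_def\<close>)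
  have "cmod (full_grad n m (total_obj J \<psi>) xs ys a) \<le> \<epsilon>" if "a \<in> full_index J n m" for a
    using that x_bound y_bound by (fastforce simp: full_index_def x_grad y_grad \<epsilon>)
  moreover have "finite (full_index J n m)"
    by (simp add: full_index_def)
  \<comment> \<open>The index set must be nonempty for its \<open>Max\<close> to be bounded
    entrywise.\<close>
  moreover have "Inr 0 \<in> full_index J n m"
    using \<open>m > 0\<close> by (auto simp: full_index_def intro!: InrI)
  ultimately show "linf_norm (full_index J n m) (full_grad n m (total_obj J \<psi>) xs ys) \<le> \<epsilon>"
    unfolding linf_norm_def by (subst Max_le_iff) auto
qed

end
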